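(* Let $G$ be a finite bipartite graph with color classes $A$ and $B$, and let $b: V(G)\to\mathbb{Z}_{\ge 0}$. Then the binary relation $\le_A$ is a partial order on the set $\mathcal{C}$ of consistent $b$-flexible components of $G$.
   Context: For $v\in V(G)$, $\delta(v)$ denotes the set of edges incident with $v$. A $b$-matching is a set $M\subseteq E(G)$ with $|\delta(v)\cap M|\le b(v)$ for every $v$; it is maximum if it has the largest possible number of edges. A vertex $v$ is $M$-loose if $|\delta(v)\cap M|<b(v)$ and $M$-tight if equality holds. An edge is allowed if it lies in some maximum $b$-matching and forbidden otherwise; an allowed edge is inevitable if it lies in every maximum $b$-matching and flexible otherwise. A flexible component is an induced subgraph $G[V(K)]$ where $K$ is a connected component of the spanning subgraph $(V(G),\{\text{flexible edges}\})$; $\mathcal{F}$ denotes the set of flexible components (they partition $V(G)$). Let $\mathcal{D}$ be the set of vertices that are $M$-loose for some maximum $b$-matching $M$. A flexible component $C$ is loose if $V(C)\cap\mathcal{D}\neq\emptyset$. A vertex $v$ is inactive if $b(v)=0$; then $G[\{v\}]$ is a flexible component, called inactive. $C\in\mathcal{F}$ is inconsistent if it is loose, or it is inactive and its vertex has a neighbor in $\mathcal{D}$; otherwise $C$ is consistent. $\mathcal{C}$ denotes the set of consistent flexible components. For $W\in\{A,B\}$ let $\overline{W}$ be the other color class. For $C_1,C_2\in\mathcal{F}$ write $C_1\preceq^\circ_W C_2$ if $C_1=C_2$, or there is an inevitable edge joining a vertex of $V(C_1)\cap W$ to a vertex of $V(C_2)\cap\overline{W}$, or there is a forbidden edge joining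 a vertex of $V(C_2)\cap W$ to a vertex of $V(C_1)\cap\overline{W}$. For $C_1,C_2\in\mathcal{C}$, $C_1\le_W C_2$ means there exist $D_1,\dots,D_k\in\mathcal{C}$ ($k\ge1$) with $D_1=C_1$, $D_k=C_2$ and $D_i\preceq^\circ_W D_{i+1}$ for all $i<k$. *)

theory Defs
  imports Main
begin

section \<open>Finite graphs\<close>

text \<open>
  Edges are abstract objects carrying a set of two endpoints, so parallel edges are allowed.
  Simple graphs are the instances whose edges are two-element vertex sets and whose
  \<open>ends\<close> is the identity.
\<close>

record ('v, 'e) mgraph =
  verts :: "'v set"
  edges :: "'e set"
  ends :: "'e \<Rightarrow> 'v set"

definition finite_graph :: "('v, 'e) mgraph \<Rightarrow> bool" where
  "finite_graph G \<longleftrightarrow> finite (verts G) \<and> finite (edges G) \<and>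
     (\<forall>e\<in>edges G. ends G e \<subseteq> verts G \<and> card (ends G e) = 2)"

definition color_classes :: "('v, 'e) mgraph \<Rightarrow> 'v set \<Rightarrow> 'v set \<Rightarrow> bool" where
  "color_classes G A B \<longleftrightarrow> A \<union> B = verts G \<and> A \<inter> B = {} \<and>
     (\<forall>e\<in>edges G. \<exists>x\<in>A. \<exists>y\<in>B. ends G e = {x, y})"

definition incident :: "('v, 'e) mgraph \<Rightarrow> 'v \<Rightarrow> 'e set" where
  "incident G v = {e \<in> edges G. v \<in> ends G e}"

definition adjacent :: "('v, 'e) mgraph \<Rightarrow> 'v \<Rightarrow> 'v \<Rightarrow> bool" where
  "adjacent G u v \<longleftrightarrow> (\<exists>e\<in>edges G. ends G e = {u, v})"

definition induced :: "('v, 'e) mgraph \<Rightarrow> 'v set \<Rightarrow> ('v, 'e) mgraph" where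
  "induced G X = G\<lparr>verts := X, edges := {e \<in> edges G. ends G e \<subseteq> X}\<rparr>"

definition spanning :: "('v, 'e) mgraph \<Rightarrow> 'e set \<Rightarrow> ('v, 'e) mgraph" where
  "spanning G F = G\<lparr>edges := F\<rparr>"

definition connected_rel :: "('v, 'e) mgraph \<Rightarrow> 'v rel" where
  "connected_rel G = {(u, v). u \<in> verts G \<and> v \<in> verts G \<and> (adjacent G)\<^sup>*\<^sup>* u v}"

definition connected_components :: "('v, 'e) mgraph \<Rightarrow> ('v, 'e) mgraph set" where
  "connected_components G = induced G ` (verts G // connected_rel G)"


section \<open>Maximum b-matchings\<close>

definition b_matching :: "('v, 'e) mgraph \<Rightarrow> ('v \<Rightarrow> nat) \<Rightarrow> 'e set \<Rightarrow> bool" where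
  "b_matching G b M \<longleftrightarrow> M \<subseteq> edges G \<and> (\<forall>v\<in>verts G. card (incident G v \<inter> M) \<le> b v)"

definition max_b_matching :: "('v, 'e) mgraph \<Rightarrow> ('v \<Rightarrow> nat) \<Rightarrow> 'e set \<Rightarrow> bool" where
  "max_b_matching G b M \<longleftrightarrow> b_matching G b M \<and> (\<forall>N. b_matching G b N \<longrightarrow> card N \<le> card M)"

definition M_loose :: "('v, 'e) mgraph \<Rightarrow> ('v \<Rightarrow> nat) \<Rightarrow> 'e set \<Rightarrow> 'v \<Rightarrow> bool" where
  "M_loose G b M v \<longleftrightarrow> card (incident G v \<inter> M) < b v"

definition allowed :: "('v, 'e) mgraph \<Rightarrow> ('v \<Rightarrow> nat) \<Rightarrow> 'e set" where
  "allowed G b = {e \<in> edges G. \<exists>M. max_b_matching G b M \<and> e \<in> M}"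

definition forbidden :: "('v, 'e) mgraph \<Rightarrow> ('v \<Rightarrow> nat) \<Rightarrow> 'e set" where
  "forbidden G b = edges G - allowed G b"

definition inevitable :: "('v, 'e) mgraph \<Rightarrow> ('v \<Rightarrow> nat) \<Rightarrow> 'e set" where
  "inevitable G b = {e \<in> allowed G b. \<forall>M. max_b_matching G b M \<longrightarrow> e \<in> M}"

definition flexible :: "('v, 'e) mgraph \<Rightarrow> ('v \<Rightarrow> nat) \<Rightarrow> 'e set" where
  "flexible G b = allowed G b - inevitable G b"

definition D_set :: "('v, 'e) mgraph \<Rightarrow> ('v \<Rightarrow> nat) \<Rightarrow> 'v set" where
  "D_set G b = {v \<in> verts G. \<exists>M. max_b_matching G b M \<and> M_loose G b M v}"


section \<open>Flexible components\<close>

definition flexible_components :: "('v, 'e) mgraph \<Rightarrow> ('v \<Rightarrow> nat) \<Rightarrow> ('v, 'e) mgraph set" where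
  "flexible_components G b =
     {induced G (verts K) | K. K \<in> connected_components (spanning G (flexible G b))}"

definition loose_component ::
  "('v, 'e) mgraph \<Rightarrow> ('v \<Rightarrow> nat) \<Rightarrow> ('v, 'e) mgraph \<Rightarrow> bool" where
  "loose_component G b C \<longleftrightarrow> verts C \<inter> D_set G b \<noteq> {}"

definition inactive :: "('v \<Rightarrow> nat) \<Rightarrow> 'v \<Rightarrow> bool" where
  "inactive b v \<longleftrightarrow> b v = 0"

definition inconsistent ::
  "('v, 'e) mgraph \<Rightarrow> ('v \<Rightarrow> nat) \<Rightarrow> ('v, 'e) mgraph \<Rightarrow> bool" where
  "inconsistent G b C \<longleftrightarrow> loose_component G b C \<or>
     (\<exists>v\<in>verts G. inactive b v \<and> C = induced G {v} \<and> (\<exists>u\<in>D_set G b. adjacent G v u))"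

definition consistent_components ::
  "('v, 'e) mgraph \<Rightarrow> ('v \<Rightarrow> nat) \<Rightarrow> ('v, 'e) mgraph set" where
  "consistent_components G b = {C \<in> flexible_components G b. \<not> inconsistent G b C}"


section \<open>The relations between components\<close>

definition joined_by ::
  "('v, 'e) mgraph \<Rightarrow> 'e set \<Rightarrow> 'v set \<Rightarrow> 'v set \<Rightarrow> bool" where
  "joined_by G F X Y \<longleftrightarrow> (\<exists>e\<in>F. \<exists>x\<in>X. \<exists>y\<in>Y. ends G e = {x, y})"

text \<open>
  The argument \<open>W\<close> is meant to be one of the two color classes of \<open>G\<close>;
  the other one is then \<open>verts G - W\<close>.
\<close>

definition prec ::
  "('v, 'e) mgraph \<Rightarrow> ('v \<Rightarrow> nat) \<Rightarrow> 'v set \<Rightarrow> ('v, 'e) mgraph \<Rightarrow> ('v, 'e) mgraph \<Rightarrow> bool" where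
  "prec G b W C1 C2 \<longleftrightarrow> C1 = C2
     \<or> joined_by G (inevitable G b) (verts C1 \<inter> W) (verts C2 \<inter> (verts G - W))
     \<or> joined_by G (forbidden G b) (verts C2 \<inter> W) (verts C1 \<inter> (verts G - W))"

definition le_rel :: "('v, 'e) mgraph \<Rightarrow> ('v \<Rightarrow> nat) \<Rightarrow> 'v set \<Rightarrow> ('v, 'e) mgraph rel" where
  "le_rel G b W = {(C1, C2). C1 \<in> consistent_components G b \<and> C2 \<in> consistent_components G b \<and>
     (\<exists>Ds. Ds \<noteq> [] \<and> set Ds \<subseteq> consistent_components G b \<and> hd Ds = C1 \<and> last Ds = C2 \<and>
        (\<forall>i. Suc i < length Ds \<longrightarrow> prec G b W (Ds ! i) (Ds ! Suc i)))}"

end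

(*
  Fix a maximum b-matching M and orient the edges of M from A to B and all other edges from B
  to A. Switching M along a directed cycle preserves all degrees, so every edge on a directed
  cycle is flexible. Conversely, inside a flexible component avoiding D all vertices are tight for
  every maximum b-matching N, so M - N and N - M have equal degrees there; the symmetric
  difference is then an Eulerian digraph, and hence the component is strongly connected.
  Since a relation step between different components is an arc that is not flexible, a cyclic
  chain of consistent components would put such an arc on a directed cycle.
*)
theory Submission
  imports Defs
begin

section \<open>Reachability, walks and lists\<close>

text \<open>Cutting a walk after its last visit to \<open>v\<close> leaves a remainder that avoids
  \<open>v\<close>. This yields simple paths by induction without a formal notion of walk.\<close>

lemma rtrancl_last_departure:
  assumes "(v, u) \<in> r\<^sup>*" "u \<noteq> v"
  shows "\<exists>w. (v, w) \<in> r \<and> (w, u) \<in> {(x, y) \<in> r. x \<noteq> v \<and> y \<noteq> v}\<^sup>*"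
  using assms
proof (induction rule: rtrancl_induct)
  case base
  then show ?case by simp
next
  case (step y z)
  show ?case
  proof (cases "y = v")
    case True
    then show ?thesis using step.hyps by blast
  next
    case False
    then obtain w where w: "(v, w) \<in> r" "(w, y) \<in> {(x, y) \<in> r. x \<noteq> v \<and> y \<noteq> v}\<^sup>*"
      using step.IH by blast
    have "(y, z) \<in> {(x, y) \<in> r. x \<noteq> v \<and> y \<noteq> v}"
      using False step by blast
    with w show ?thesis by (meson rtrancl.rtrancl_into_rtrancl)
  qed
qed

text \<open>Turns reachability into the list form that \<open>le_rel\<close> demands. The hypothesis
  \<open>x \<in> S\<close> covers the walk of length zero, since \<open>r\<^sup>*\<close> also
  relates points outside \<open>S\<close> to themselves.\<close>

lemma rtrancl_as_list:
  assumes "(x, y) \<in> r\<^sup>*" "x \<in> S" "r \<subseteq> S \<times> S"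
  shows "\<exists>zs. zs \<noteq> [] \<and> set zs \<subseteq> S \<and> hd zs = x \<and> last zs = y \<and>
           (\<forall>i. Suc i < length zs \<longrightarrow> (zs ! i, zs ! Suc i) \<in> r)"
  using assms(1)
proof (induction rule: rtrancl_induct)
  case base
  then show ?case using assms(2) by (intro exI[of _ "[x]"]) auto
next
  case (step y z)
  then obtain zs where zs: "zs \<noteq> []" "set zs \<subseteq> S" "hd zs = x" "last zs = y"
    "\<And>i. Suc i < length zs \<Longrightarrow> (zs ! i, zs ! Suc i) \<in> r" by blast
  have "((zs @ [z]) ! i, (zs @ [z]) ! Suc i) \<in> r" if "Suc i < length (zs @ [z])" for i
  proof (cases "Suc i < length zs")
    case True
    then show ?thesis using zs(5) by (simp add: nth_append)
  next
    case False
    then have "i = length zs - 1" "Suc i = length zs" using that zs(1) by auto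
    then show ?thesis using step.hyps(2) zs(1,4) by (simp add: nth_append last_conv_nth)
  qed
  moreover have "z \<in> S" using step.hyps(2) assms(3) by blast
  ultimately show ?case using zs(1-3) by (intro exI[of _ "zs @ [z]"]) auto
qed

lemma list_as_rtrancl:
  assumes "zs \<noteq> []" "\<And>i. Suc i < length zs \<Longrightarrow> (zs ! i, zs ! Suc i) \<in> r"
  shows "(hd zs, last zs) \<in> r\<^sup>*"
proof -
  have "(zs ! 0, zs ! i) \<in> r\<^sup>*" if "i < length zs" for i
    using that
  proof (induction i)
    case (Suc i)
    then show ?case using assms(2) by (meson Suc_lessD rtrancl.rtrancl_into_rtrancl)
  qed simp
  then show ?thesis using assms(1) by (simp add: hd_conv_nth last_conv_nth)
qed

section \<open>Bipartite graphs directed by a matching\<close>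

locale bipartite_graph =
  fixes G :: "('v, 'e) mgraph" and A B :: "'v set"
  assumes finite_graph: "finite_graph G"
    and color_classes: "color_classes G A B"
begin

lemma finite_verts: "finite (verts G)" and finite_edges: "finite (edges G)"
  using finite_graph by (auto simp: finite_graph_def)

lemma verts_eq: "verts G = A \<union> B" and disjoint_classes: "A \<inter> B = {}"
  using color_classes by (auto simp: color_classes_def)

text \<open>Meant for \<open>W\<close> equal to \<open>A\<close> or \<open>B\<close>: an edge has
  exactly one end in each class, so the description picks a unique vertex.\<close>

definition end_in :: "'v set \<Rightarrow> 'e \<Rightarrow> 'v" where
  "end_in W e = (THE x. x \<in> W \<and> x \<in> ends G e)"

lemma end_in_classes:
  assumes "e \<in> edges G"
  shows "end_in A e \<in> A" "end_in B e \<in> B" "ends G e = {end_in A e, end_in B e}"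
proof -
  obtain x y where xy: "x \<in> A" "y \<in> B" "ends G e = {x, y}"
    using assms color_classes by (auto simp: color_classes_def)
  have "end_in A e = x" "end_in B e = y"
    unfolding end_in_def using xy disjoint_classes by (auto intro!: the_equality)
  with xy show "end_in A e \<in> A" "end_in B e \<in> B" "ends G e = {end_in A e, end_in B e}"
    by auto
qed

lemma end_in_eq:
  assumes "e \<in> edges G" "ends G e = {x, y}" "x \<in> A" "y \<in> B"
  shows "end_in A e = x" "end_in B e = y"
  using end_in_classes[OF assms(1)] assms disjoint_classes by (auto simp: doubleton_eq_iff)

definition tail :: "'e set \<Rightarrow> 'e \<Rightarrow> 'v" where
  "tail M e = (if e \<in> M then end_in A e else end_in B e)"

definition head :: "'e set \<Rightarrow> 'e \<Rightarrow> 'v" where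
  "head M e = (if e \<in> M then end_in B e else end_in A e)"

text \<open>\<open>M\<close> only fixes the directions; \<open>F\<close> selects the edges that take
  part, so that subgraphs of one and the same digraph can be compared.\<close>

definition arcs :: "'e set \<Rightarrow> 'e set \<Rightarrow> 'v rel" where
  "arcs M F = (\<lambda>e. (tail M e, head M e)) ` F"

lemma arcs_mono: "F \<subseteq> F' \<Longrightarrow> arcs M F \<subseteq> arcs M F'"
  by (auto simp: arcs_def)

lemma ends_tail_head: "e \<in> edges G \<Longrightarrow> ends G e = {tail M e, head M e}"
  using end_in_classes[of e] by (auto simp: tail_def head_def)

lemma tail_neq_head: "e \<in> edges G \<Longrightarrow> tail M e \<noteq> head M e"
  using end_in_classes[of e] disjoint_classes by (auto simp: tail_def head_def)

section \<open>Degree balance and switching\<close>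

text \<open>Out-degree minus in-degree at \<open>w\<close> in the digraph formed by
  \<open>P\<close>. Summing over edges instead of vertex pairs counts parallel edges
  separately.\<close>

definition excess :: "'e set \<Rightarrow> 'e set \<Rightarrow> 'v \<Rightarrow> int" where
  "excess M P w = (\<Sum>e\<in>P. of_bool (tail M e = w) - of_bool (head M e = w))"

text \<open>At a vertex of \<open>A\<close> the edges of \<open>M\<close> go out and the others come
  in; at a vertex of \<open>B\<close> it is the other way round, hence the opposite signs.\<close>

lemma excess_eq:
  assumes "P \<subseteq> edges G"
  shows "w \<in> A \<Longrightarrow> excess M P w =
           int (card (incident G w \<inter> (P \<inter> M))) - int (card (incident G w \<inter> (P - M)))"
    and "w \<in> B \<Longrightarrow> excess M P w =
           int (card (incident G w \<inter> (P - M))) - int (card (incident G w \<inter> (P \<inter> M)))"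
proof -
  have fin: "finite P" using assms finite_edges finite_subset by blast
  have ex: "excess M P w = int (card {e \<in> P. tail M e = w}) - int (card {e \<in> P. head M e = w})"
    using fin by (simp add: excess_def sum_subtractf sum.If_cases of_bool_def Int_def)
  have cases: "tail M e = w \<longleftrightarrow> w \<in> ends G e \<and> (e \<in> M \<longleftrightarrow> w \<in> A)"
    "head M e = w \<longleftrightarrow> w \<in> ends G e \<and> (e \<in> M \<longleftrightarrow> w \<in> B)" if "e \<in> P" "w \<in> verts G" for e
  proof -
    have "e \<in> edges G" using that assms by blast
    from end_in_classes[OF this] that disjoint_classes verts_eq
    show "tail M e = w \<longleftrightarrow> w \<in> ends G e \<and> (e \<in> M \<longleftrightarrow> w \<in> A)"
      "head M e = w \<longleftrightarrow> w \<in> ends G e \<and> (e \<in> M \<longleftrightarrow> w \<in> B)"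
      by (auto simp: tail_def head_def)
  qed
  {
    assume w: "w \<in> A"
    then have "{e \<in> P. tail M e = w} = incident G w \<inter> (P \<inter> M)"
      "{e \<in> P. head M e = w} = incident G w \<inter> (P - M)"
      using cases assms disjoint_classes verts_eq by (auto simp: incident_def)
    with ex show "excess M P w =
           int (card (incident G w \<inter> (P \<inter> M))) - int (card (incident G w \<inter> (P - M)))" by simp
  next
    assume w: "w \<in> B"
    then have "{e \<in> P. tail M e = w} = incident G w \<inter> (P - M)"
      "{e \<in> P. head M e = w} = incident G w \<inter> (P \<inter> M)"
      using cases assms disjoint_classes verts_eq by (auto simp: incident_def)
    with ex show "excess M P w =
           int (card (incident G w \<inter> (P - M))) - int (card (incident G w \<inter> (P \<inter> M)))" by simp
  }
qed

lemma excess_eq_0_iff: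
  assumes "P \<subseteq> edges G" "w \<in> verts G"
  shows "excess M P w = 0 \<longleftrightarrow>
           card (incident G w \<inter> (P \<inter> M)) = card (incident G w \<inter> (P - M))"
  using excess_eq[OF assms(1), of w M] assms(2) verts_eq by auto

text \<open>After the sums are exchanged, each edge contributes its net crossing of the boundary of
  \<open>R\<close>: 1 if it leaves \<open>R\<close>, -1 if it enters, 0 otherwise.\<close>

lemma sum_excess:
  assumes "finite P" "finite R"
  shows "(\<Sum>w\<in>R. excess M P w) = (\<Sum>e\<in>P. of_bool (tail M e \<in> R) - of_bool (head M e \<in> R))"
proof -
  have "(\<Sum>w\<in>R. excess M P w) =
      (\<Sum>e\<in>P. \<Sum>w\<in>R. of_bool (tail M e = w) - of_bool (head M e = w))"
    unfolding excess_def by (rule sum.swap)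
  also have "\<dots> = (\<Sum>e\<in>P. of_bool (tail M e \<in> R) - of_bool (head M e \<in> R))"
    using assms(2) by (intro sum.cong) (auto simp: sum_subtractf of_bool_def)
  finally show ?thesis .
qed

text \<open>Every edge has exactly one end in \<open>A\<close>. Hence a change that keeps all
  degrees also keeps the number of edges.\<close>

lemma card_eq_sum_degrees:
  assumes "M \<subseteq> edges G"
  shows "card M = (\<Sum>a\<in>A. card (incident G a \<inter> M))"
proof -
  have "M = (\<Union>a\<in>A. incident G a \<inter> M)"
    using assms end_in_classes by (fastforce simp: incident_def)
  then have "card M = card (\<Union>a\<in>A. incident G a \<inter> M)" by simp
  also have "\<dots> = (\<Sum>a\<in>A. card (incident G a \<inter> M))"
  proof (rule card_UN_disjoint)
    show "finite A" using finite_verts verts_eq by simp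
    show "\<forall>a\<in>A. finite (incident G a \<inter> M)"
      using assms finite_edges finite_subset by blast
    show "\<forall>a\<in>A. \<forall>a'\<in>A. a \<noteq> a' \<longrightarrow> incident G a \<inter> M \<inter> (incident G a' \<inter> M) = {}"
      using end_in_classes disjoint_classes by (fastforce simp: incident_def)
  qed
  finally show ?thesis .
qed

text \<open>Zero excess means that at each vertex as many edges of \<open>M\<close> are removed as
  new ones are added. All degrees survive, and with them the size.\<close>

lemma max_b_matching_switch:
  assumes M: "max_b_matching G b M" and P: "P \<subseteq> edges G"
    and bal: "\<And>w. w \<in> verts G \<Longrightarrow> excess M P w = 0"
  shows "max_b_matching G b (sym_diff M P)"
proof -
  have ME: "M \<subseteq> edges G" using M by (simp add: max_b_matching_def b_matching_def)
  have deg: "card (incident G w \<inter> sym_diff M P) = card (incident G w \<inter> M)" if "w \<in> verts G" for w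
  proof -
    let ?I = "incident G w"
    have fin: "finite ?I" using finite_edges by (simp add: incident_def)
    have "card (?I \<inter> sym_diff M P) = card (?I \<inter> (M - P)) + card (?I \<inter> (P - M))"
      using fin by (subst card_Un_disjoint[symmetric]) (auto intro: arg_cong[of _ _ card])
    also have "\<dots> = card (?I \<inter> (M - P)) + card (?I \<inter> (P \<inter> M))"
      using bal[OF that] excess_eq_0_iff[OF P that] by simp
    also have "\<dots> = card (?I \<inter> M)"
      using fin by (subst card_Un_disjoint[symmetric]) (auto intro: arg_cong[of _ _ card])
    finally show ?thesis .
  qed
  have sub: "sym_diff M P \<subseteq> edges G" using ME P by blast
  have "card (sym_diff M P) = card M"
    using card_eq_sum_degrees[OF ME] card_eq_sum_degrees[OF sub] deg verts_eq by simp
  then show ?thesis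
    using M deg sub by (simp add: max_b_matching_def b_matching_def)
qed

text \<open>\<open>P\<close> is the edge set of a simple path, described only by its degree balance.
  That no arc of \<open>P\<close> enters \<open>v\<close> lets a closing edge with head
  \<open>v\<close> be added later without already lying in \<open>P\<close>.\<close>

lemma simple_path:
  assumes "finite F" "F \<subseteq> edges G" "(v, u) \<in> (arcs M F)\<^sup>*"
  shows "\<exists>P\<subseteq>F. (\<forall>w. excess M P w = of_bool (w = v) - of_bool (w = u)) \<and>
           (\<forall>e\<in>P. head M e \<noteq> v)"
  using assms
proof (induction F arbitrary: v rule: finite_psubset_induct)
  case (psubset F)
  show ?case
  proof (cases "v = u")
    case True
    then show ?thesis by (intro exI[of _ "{}"]) (simp add: excess_def)
  next
    case False
    \<comment> \<open>Deleting every edge at \<open>v\<close> makes the edge set strictly smaller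
      and ensures that the rest of the path neither reuses \<open>f\<close> nor returns to
      \<open>v\<close>.\<close>
    define F' where "F' = {e \<in> F. tail M e \<noteq> v \<and> head M e \<noteq> v}"
    have "{(x, y) \<in> arcs M F. x \<noteq> v \<and> y \<noteq> v} = arcs M F'"
      by (auto simp: arcs_def F'_def)
    then obtain w where w: "(v, w) \<in> arcs M F" "(w, u) \<in> (arcs M F')\<^sup>*"
      using rtrancl_last_departure[OF psubset.prems(2)] False by metis
    then obtain f where f: "f \<in> F" "tail M f = v" "head M f = w" by (auto simp: arcs_def)
    have "F' \<subset> F" using f by (auto simp: F'_def)
    then obtain P where P: "P \<subseteq> F'" "\<And>x. excess M P x = of_bool (x = w) - of_bool (x = u)"
      using psubset.IH[of F' w] psubset.prems(1) w(2) by blast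
    have "finite P" "f \<notin> P"
      using P(1) f psubset.hyps finite_subset[of P F] by (auto simp: F'_def)
    \<comment> \<open>The arc \<open>f\<close> adds 1 at \<open>v\<close> and -1 at
      \<open>w\<close>; the latter cancels the 1 that \<open>P\<close> has at its start
      \<open>w\<close>.\<close>
    then have "excess M (insert f P) x = of_bool (x = v) - of_bool (x = u)" for x
      using P(2)[of x] f by (auto simp: excess_def)
    moreover have "\<forall>e\<in>insert f P. head M e \<noteq> v"
      using P(1) f tail_neq_head[of f M] psubset.prems(1) by (auto simp: F'_def)
    moreover have "insert f P \<subseteq> F" using P(1) f by (auto simp: F'_def)
    ultimately show ?thesis by blast
  qed
qed

section \<open>Flexible edges and directed cycles\<close>

lemma flexible_iff:
  "e \<in> flexible G b \<longleftrightarrow> e \<in> edges G \<and>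
     (\<exists>M. max_b_matching G b M \<and> e \<in> M) \<and> (\<exists>N. max_b_matching G b N \<and> e \<notin> N)"
  by (auto simp: flexible_def inevitable_def allowed_def)

text \<open>A simple path from the head back to the tail, closed by \<open>e\<close>, is balanced
  everywhere. Switching along it gives a second maximum b-matching that differs from
  \<open>M\<close> on \<open>e\<close>.\<close>

lemma flexible_if_on_cycle:
  assumes M: "max_b_matching G b M" and e: "e \<in> edges G"
    and path: "(head M e, tail M e) \<in> (arcs M (edges G))\<^sup>*"
  shows "e \<in> flexible G b"
proof -
  obtain P where P: "P \<subseteq> edges G"
    "\<And>w. excess M P w = of_bool (w = head M e) - of_bool (w = tail M e)"
    "\<forall>f\<in>P. head M f \<noteq> head M e"
    using simple_path[OF finite_edges _ path] by blast
  \<comment> \<open>No edge of \<open>P\<close> has the head of \<open>e\<close> as its head, so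
    \<open>e\<close> itself is not among them.\<close>
  have "finite P" "e \<notin> P" using P finite_edges finite_subset by blast+
  then have "excess M (insert e P) w = 0" for w
    using P(2)[of w] by (auto simp: excess_def)
  then have "max_b_matching G b (sym_diff M (insert e P))"
    using max_b_matching_switch[OF M] P(1) e by simp
  moreover have "e \<in> sym_diff M (insert e P) \<longleftrightarrow> e \<notin> M" by auto
  ultimately show ?thesis using M e unfolding flexible_iff by metis
qed

text \<open>\<open>X\<close> stands for the vertex set of a consistent component. A second maximum
  b-matching \<open>N\<close> disagrees with \<open>M\<close> on \<open>e\<close>, and their
  difference \<open>H\<close> is balanced on \<open>X\<close>; the set \<open>R\<close> of vertices
  reachable from the head of \<open>e\<close> within \<open>H\<close> must then contain the tail as
  well.\<close>

lemma flexible_on_cycle: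
  assumes M: "max_b_matching G b M" and e: "e \<in> flexible G b"
    and X: "X \<subseteq> verts G" "ends G e \<subseteq> X" "X \<inter> D_set G b = {}"
    and closed: "\<And>f. f \<in> flexible G b \<Longrightarrow> ends G f \<inter> X \<noteq> {} \<Longrightarrow> ends G f \<subseteq> X"
  shows "(head M e, tail M e) \<in> (arcs M (edges G))\<^sup>*"
proof -
  obtain N where N: "max_b_matching G b N" "e \<in> M \<longleftrightarrow> e \<notin> N"
    using e unfolding flexible_iff by blast
  define H where "H = sym_diff M N"
  have ME: "M \<subseteq> edges G" and NE: "N \<subseteq> edges G"
    using M N(1) by (auto simp: max_b_matching_def b_matching_def)
  have HE: "H \<subseteq> edges G" using ME NE by (auto simp: H_def)
  have finH: "finite H" using HE finite_edges finite_subset by blast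
  \<comment> \<open>An edge in exactly one of two maximum b-matchings is flexible.\<close>
  have Hflex: "H \<subseteq> flexible G b"
  proof
    fix f assume "f \<in> H"
    then have "f \<in> edges G" "f \<in> M \<and> f \<notin> N \<or> f \<in> N \<and> f \<notin> M" using HE by (auto simp: H_def)
    then show "f \<in> flexible G b" using M N(1) unfolding flexible_iff by blast
  qed
  have eH: "e \<in> H" using N(2) by (auto simp: H_def)
  have tight: "card (incident G w \<inter> L) = b w" if "max_b_matching G b L" "w \<in> X" for L w
  proof -
    have "w \<in> verts G" "w \<notin> D_set G b" using that X by auto
    then have "\<not> card (incident G w \<inter> L) < b w"
      using that(1) by (auto simp: D_set_def M_loose_def)
    moreover have "card (incident G w \<inter> L) \<le> b w"
      using that(1) \<open>w \<in> verts G\<close> by (simp add: max_b_matching_def b_matching_def)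
    ultimately show ?thesis by simp
  qed
  \<comment> \<open>Both matchings have degree \<open>b w\<close> at \<open>w\<close>; removing
    their common edges leaves equally many of each.\<close>
  have bal: "excess M H w = 0" if "w \<in> X" for w
  proof -
    let ?I = "incident G w"
    have fin: "finite ?I" using finite_edges by (simp add: incident_def)
    have split: "card (?I \<inter> L) = card (?I \<inter> L \<inter> L') + card (?I \<inter> (L - L'))" for L L'
      using card_Int_Diff[of "?I \<inter> L" L'] fin by (simp add: Int_Diff)
    have "card (?I \<inter> M \<inter> N) = card (?I \<inter> N \<inter> M)" by (simp add: Int_ac)
    then have "card (?I \<inter> (M - N)) = card (?I \<inter> (N - M))"
      using split[of M N] split[of N M] tight[OF M that] tight[OF N(1) that] by linarith
    moreover have "H \<inter> M = M - N" "H - M = N - M" by (auto simp: H_def)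
    moreover have "w \<in> verts G" using X(1) that by blast
    ultimately show ?thesis using excess_eq_0_iff[OF HE] by simp
  qed
  \<comment> \<open>Reachability uses \<open>H\<close> only: its arcs are flexible, so
    \<open>closed\<close> keeps \<open>R\<close> inside \<open>X\<close>, where the balance is
    known.\<close>
  define R where "R = {w. (head M e, w) \<in> (arcs M H)\<^sup>*}"
  have "w \<in> X" if "(head M e, w) \<in> (arcs M H)\<^sup>*" for w
    using that
  proof (induction rule: rtrancl_induct)
    case base
    then show ?case using X(2) ends_tail_head[of e M] eH HE by auto
  next
    case (step y z)
    then obtain f where f: "f \<in> H" "tail M f = y" "head M f = z" by (auto simp: arcs_def)
    then have "ends G f = {y, z}" using ends_tail_head HE by blast
    then show ?case using closed[of f] f(1) Hflex step.IH by auto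
  qed
  then have RX: "R \<subseteq> X" unfolding R_def by blast
  have "finite R" using finite_subset[OF subset_trans[OF RX X(1)] finite_verts] .
  have closedR: "head M f \<in> R" if "f \<in> H" "tail M f \<in> R" for f
  proof -
    have "(head M e, tail M f) \<in> (arcs M H)\<^sup>*" using that(2) by (simp add: R_def)
    also have "(tail M f, head M f) \<in> arcs M H" using that(1) by (auto simp: arcs_def)
    finally show ?thesis by (simp add: R_def)
  qed
  text \<open>No arc leaves R, and the out- and in-degrees over R agree, so no arc enters R.\<close>
  have "(\<Sum>f\<in>H. of_bool (head M f \<in> R) - of_bool (tail M f \<in> R) :: int) = 0"
  proof -
    have "(\<Sum>w\<in>R. excess M H w) = 0" using bal RX by (intro sum.neutral) blast
    then show ?thesis
      using sum_excess[OF finH \<open>finite R\<close>, of M] by (simp add: sum_subtractf)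
  qed
  moreover have "0 \<le> (of_bool (head M f \<in> R) - of_bool (tail M f \<in> R) :: int)" if "f \<in> H" for f
    using closedR[OF that] by simp
  ultimately have "\<forall>f\<in>H. of_bool (head M f \<in> R) - of_bool (tail M f \<in> R) = (0 :: int)"
    using sum_nonneg_eq_0_iff[OF finH, of "\<lambda>f. of_bool (head M f \<in> R) - of_bool (tail M f \<in> R) :: int"]
    by blast
  moreover have "head M e \<in> R" by (simp add: R_def)
  ultimately have "tail M e \<in> R" using eH by (force simp: of_bool_def split: if_splits)
  then have "(head M e, tail M e) \<in> (arcs M H)\<^sup>*" by (simp add: R_def)
  then show ?thesis
    using rtrancl_mono[OF arcs_mono[OF HE]] by blast
qed

section \<open>Maximum b-matchings and connectivity of components\<close>

lemma max_b_matching_exists: "\<exists>M. max_b_matching G b M"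
proof -
  let ?S = "{M. b_matching G b M}"
  have "?S \<subseteq> Pow (edges G)" by (auto simp: b_matching_def)
  then have "finite ?S" using finite_edges finite_subset by blast
  moreover have "{} \<in> ?S" by (simp add: b_matching_def)
  ultimately have "Max (card ` ?S) \<in> card ` ?S" by (intro Max_in) blast+
  then obtain M where "M \<in> ?S" "card M = Max (card ` ?S)" by (metis imageE)
  moreover have "card N \<le> Max (card ` ?S)" if "N \<in> ?S" for N
    using that \<open>finite ?S\<close> by simp
  ultimately show ?thesis unfolding max_b_matching_def by auto
qed

text \<open>Adjacency by flexible edges is symmetric, so a component's vertex set is everything
  reachable from one representative. This gives both connectivity and closure under flexible
  edges.\<close>

lemma flexible_component_props:
  assumes C: "C \<in> flexible_components G b"
  shows "verts C \<subseteq> verts G" "verts C \<noteq> {}"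
    "\<lbrakk>x \<in> verts C; y \<in> verts C\<rbrakk> \<Longrightarrow> (adjacent (spanning G (flexible G b)))\<^sup>*\<^sup>* x y"
    "\<lbrakk>f \<in> flexible G b; ends G f \<inter> verts C \<noteq> {}\<rbrakk> \<Longrightarrow> ends G f \<subseteq> verts C"
proof -
  let ?S = "spanning G (flexible G b)"
  have vS: "verts ?S = verts G" by (simp add: spanning_def)
  have sym: "symp (adjacent ?S)" by (auto simp: adjacent_def symp_def insert_commute)
  then have syms: "(adjacent ?S)\<^sup>*\<^sup>* y x" if "(adjacent ?S)\<^sup>*\<^sup>* x y" for x y
    using that by (metis symp_rtranclp sympD)
  obtain z where z: "z \<in> verts G" "verts C = connected_rel ?S `` {z}"
    using C by (auto simp: flexible_components_def connected_components_def induced_def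
        quotient_def vS)
  then have vC: "x \<in> verts C \<longleftrightarrow> x \<in> verts G \<and> (adjacent ?S)\<^sup>*\<^sup>* z x" for x
    by (auto simp: connected_rel_def vS)
  show "verts C \<subseteq> verts G" "verts C \<noteq> {}" using vC z(1) by auto
  show "(adjacent ?S)\<^sup>*\<^sup>* x y" if "x \<in> verts C" "y \<in> verts C"
    using that vC syms by (meson rtranclp_trans)
  assume f: "f \<in> flexible G b" "ends G f \<inter> verts C \<noteq> {}"
  then have fE: "f \<in> edges G" by (simp add: flexible_iff)
  then obtain x y where xy: "ends G f = {x, y}" "x \<in> verts C"
    using f(2) ends_tail_head[of f "{}"] by (auto simp: insert_commute)
  have "adjacent ?S x y" using f(1) xy by (auto simp: adjacent_def spanning_def)
  moreover have "y \<in> verts G"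
    using fE xy finite_graph by (auto simp: finite_graph_def)
  ultimately have "y \<in> verts C" using xy(2) vC by (meson rtranclp.rtrancl_into_rtrancl)
  then show "ends G f \<subseteq> verts C" using xy by simp
qed

text \<open>A flexible edge inside the component can be traversed in both directions: forwards as an
  arc, backwards along the rest of a directed cycle through it.\<close>

lemma consistent_component_strongly_connected:
  assumes M: "max_b_matching G b M" and C: "C \<in> consistent_components G b"
    and xy: "x \<in> verts C" "y \<in> verts C"
  shows "(x, y) \<in> (arcs M (edges G))\<^sup>*"
proof -
  have fc: "C \<in> flexible_components G b" and D: "verts C \<inter> D_set G b = {}"
    using C by (auto simp: consistent_components_def inconsistent_def loose_component_def)
  note props = flexible_component_props[OF fc]
  \<comment> \<open>Membership in \<open>C\<close> is carried along so that each next flexible edge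
    is known to lie inside the component.\<close>
  have "y \<in> verts C \<and> (x, y) \<in> (arcs M (edges G))\<^sup>*"
    if "(adjacent (spanning G (flexible G b)))\<^sup>*\<^sup>* x y" for y
    using that
  proof (induction rule: rtranclp_induct)
    case base
    then show ?case using xy(1) by simp
  next
    case (step y z)
    then obtain f where f: "f \<in> flexible G b" "ends G f = {y, z}"
      by (auto simp: adjacent_def spanning_def)
    then have fE: "f \<in> edges G" by (simp add: flexible_iff)
    have sub: "ends G f \<subseteq> verts C" using props(4) f step.IH by auto
    have "(tail M f, head M f) \<in> arcs M (edges G)" using fE by (auto simp: arcs_def)
    moreover have "(head M f, tail M f) \<in> (arcs M (edges G))\<^sup>*"
      using flexible_on_cycle[OF M f(1) props(1) sub D] props(4) by blast
    moreover have "y = tail M f \<and> z = head M f \<or> y = head M f \<and> z = tail M f"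
      using ends_tail_head[OF fE, of M] f(2) by (auto simp: doubleton_eq_iff)
    ultimately have "(y, z) \<in> (arcs M (edges G))\<^sup>*" by auto
    then show ?case using step.IH sub f(2) by (auto intro: rtrancl_trans)
  qed
  then show ?thesis using props(3) xy by blast
qed

section \<open>Relation steps as arcs, and antisymmetry\<close>

text \<open>The two clauses of \<open>prec\<close> fit the orientation: inevitable edges lie in
  \<open>M\<close> and run from \<open>A\<close> to \<open>B\<close>, forbidden edges lie outside
  \<open>M\<close> and run from \<open>B\<close> to \<open>A\<close>. Either way the arc goes from
  \<open>C1\<close> to \<open>C2\<close>.\<close>

lemma prec_imp_rigid_arc:
  assumes M: "max_b_matching G b M" and p: "prec G b A C1 C2" "C1 \<noteq> C2"
  shows "\<exists>e\<in>edges G - flexible G b. tail M e \<in> verts C1 \<and> head M e \<in> verts C2"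
proof -
  have B: "verts G - A = B" using verts_eq disjoint_classes by auto
  consider (inevitable) e x y where "e \<in> inevitable G b" "ends G e = {x, y}"
      "x \<in> verts C1 \<inter> A" "y \<in> verts C2 \<inter> B"
    | (forbidden) e x y where "e \<in> forbidden G b" "ends G e = {x, y}"
      "x \<in> verts C2 \<inter> A" "y \<in> verts C1 \<inter> B"
    using p by (auto simp: prec_def joined_by_def B)
  then show ?thesis
  proof cases
    case inevitable
    then have "e \<in> edges G" "e \<in> M" "e \<notin> flexible G b"
      using M by (auto simp: inevitable_def allowed_def flexible_def)
    with inevitable show ?thesis
      using end_in_eq[of e x y] by (intro bexI[of _ e]) (auto simp: tail_def head_def)
  next
    case forbidden
    then have "e \<in> edges G" "e \<notin> M" "e \<notin> flexible G b"
      using M by (auto simp: forbidden_def allowed_def flexible_def)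
    with forbidden show ?thesis
      using end_in_eq[of e x y] by (intro bexI[of _ e]) (auto simp: tail_def head_def)
  qed
qed

definition consistent_prec :: "('v \<Rightarrow> nat) \<Rightarrow> ('v, 'e) mgraph rel" where
  "consistent_prec b = {(C1, C2) \<in> consistent_components G b \<times> consistent_components G b.
     prec G b A C1 C2}"

text \<open>Replaces lists by a reflexive transitive closure. Membership of \<open>C1\<close> is
  stated separately because the closure is reflexive on all graphs, not just on consistent
  components.\<close>

lemma le_rel_iff:
  "(C1, C2) \<in> le_rel G b A \<longleftrightarrow>
     C1 \<in> consistent_components G b \<and> (C1, C2) \<in> (consistent_prec b)\<^sup>*"
proof
  assume "(C1, C2) \<in> le_rel G b A"
  then obtain Ds where Ds: "C1 \<in> consistent_components G b" "Ds \<noteq> []"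
    "set Ds \<subseteq> consistent_components G b" "hd Ds = C1" "last Ds = C2"
    "\<And>i. Suc i < length Ds \<Longrightarrow> prec G b A (Ds ! i) (Ds ! Suc i)"
    by (auto simp: le_rel_def)
  have "(Ds ! i, Ds ! Suc i) \<in> consistent_prec b" if "Suc i < length Ds" for i
    using that Ds(3,6) by (auto simp: consistent_prec_def subset_iff)
  then show "C1 \<in> consistent_components G b \<and> (C1, C2) \<in> (consistent_prec b)\<^sup>*"
    using list_as_rtrancl[of Ds] Ds by auto
next
  assume *: "C1 \<in> consistent_components G b \<and> (C1, C2) \<in> (consistent_prec b)\<^sup>*"
  have "consistent_prec b \<subseteq> consistent_components G b \<times> consistent_components G b"
    by (auto simp: consistent_prec_def)
  from rtrancl_as_list[OF _ _ this] * obtain Ds where Ds: "Ds \<noteq> []"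
    "set Ds \<subseteq> consistent_components G b" "hd Ds = C1" "last Ds = C2"
    "\<forall>i. Suc i < length Ds \<longrightarrow> (Ds ! i, Ds ! Suc i) \<in> consistent_prec b" by blast
  moreover have "C2 \<in> consistent_components G b" using Ds(1,2,4) last_in_set by blast
  ultimately show "(C1, C2) \<in> le_rel G b A"
    using * unfolding le_rel_def consistent_prec_def by blast
qed

text \<open>Walks inside components, available by strong connectivity, alternate with the arcs that
  realise the relation steps.\<close>

lemma consistent_prec_reach:
  assumes M: "max_b_matching G b M" and "(C1, C2) \<in> (consistent_prec b)\<^sup>*"
    and "C1 \<in> consistent_components G b" "x \<in> verts C1" "y \<in> verts C2"
  shows "(x, y) \<in> (arcs M (edges G))\<^sup>*"
  using assms(2,5)
proof (induction arbitrary: y rule: rtrancl_induct)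
  case base
  then show ?case using consistent_component_strongly_connected[OF M] assms(3,4) by blast
next
  case (step C D)
  show ?case
  proof (cases "C = D")
    case True
    then show ?thesis using step by blast
  next
    case False
    then obtain e where e: "e \<in> edges G" "tail M e \<in> verts C" "head M e \<in> verts D"
      using prec_imp_rigid_arc[OF M] step.hyps(2) by (auto simp: consistent_prec_def)
    have "(x, tail M e) \<in> (arcs M (edges G))\<^sup>*" using step.IH e(2) .
    also have "(tail M e, head M e) \<in> arcs M (edges G)" using e(1) by (auto simp: arcs_def)
    also have "(head M e, y) \<in> (arcs M (edges G))\<^sup>*"
      using consistent_component_strongly_connected[OF M _ e(3) step.prems] step.hyps(2)
      by (auto simp: consistent_prec_def)
    finally show ?thesis .
  qed
qed

lemma antisym_le_rel: "antisym (le_rel G b A)"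
proof (rule antisymI, rule ccontr)
  fix C1 C2
  assume le: "(C1, C2) \<in> le_rel G b A" "(C2, C1) \<in> le_rel G b A" and neq: "C1 \<noteq> C2"
  obtain M where M: "max_b_matching G b M" using max_b_matching_exists by blast
  \<comment> \<open>Discarding trivial steps makes the first step of the chain leave
    \<open>C1\<close>, so it is realised by an arc that is not flexible.\<close>
  have "(C1, C2) \<in> (consistent_prec b - Id)\<^sup>*"
    using le(1) by (simp add: le_rel_iff rtrancl_r_diff_Id)
  then obtain C where C: "(C1, C) \<in> consistent_prec b" "C1 \<noteq> C"
    "(C, C2) \<in> (consistent_prec b)\<^sup>*"
    using neq by (metis DiffE IdI converse_rtranclE rtrancl_r_diff_Id)
  obtain e where e: "e \<in> edges G" "e \<notin> flexible G b" "tail M e \<in> verts C1" "head M e \<in> verts C"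
    using prec_imp_rigid_arc[OF M] C(1,2) by (auto simp: consistent_prec_def)
  \<comment> \<open>The rest of the chain to \<open>C2\<close>, followed by the chain back, returns
    to \<open>C1\<close> and closes a directed cycle through \<open>e\<close>.\<close>
  have "(C, C1) \<in> (consistent_prec b)\<^sup>*"
    using C(3) le(2) by (auto simp: le_rel_iff)
  moreover have "C \<in> consistent_components G b" using C(1) by (auto simp: consistent_prec_def)
  ultimately have "(head M e, tail M e) \<in> (arcs M (edges G))\<^sup>*"
    using consistent_prec_reach[OF M] e(3,4) by blast
  then show False using flexible_if_on_cycle[OF M e(1)] e(2) by blast
qed

end

theorem mainTheorem1:
  fixes G :: "('v, 'e) mgraph"
    and A B :: "'v set"
    and b :: "'v \<Rightarrow> nat"
  assumes "finite_graph G"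
    and "color_classes G A B"
  shows "partial_order_on (consistent_components G b) (le_rel G b A)"
proof -
  interpret bipartite_graph G A B using assms by unfold_locales
  have "le_rel G b A \<subseteq> consistent_components G b \<times> consistent_components G b"
    by (auto simp: le_rel_def)
  moreover have "refl_on (consistent_components G b) (le_rel G b A)"
    by (auto simp: refl_on_def le_rel_iff)
  moreover have "trans (le_rel G b A)"
    by (auto simp: le_rel_iff intro!: transI)
  ultimately show ?thesis
    using antisym_le_rel by (auto simp: partial_order_on_def preorder_on_def)
qed

end
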